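(* Let $(X,\langle\cdot,\cdot\rangle)$ be a real Hilbert space with $\dim(X)\ge 3$ (with $X^*$ identified with $X$), and let $T:X\to X$ be a continuous potential operator which is compact and of class $C^1$. For $x\in X$ put $J_T(x)=\int_0^1\langle T(sx),x\rangle\,ds$. Assume that $$\liminf_{\|x\|\to+\infty}\frac{J_T(x)}{\|x\|^2}\ge 0$$ and that, for some $\lambda_0\ge 0$, $$\lim_{\|x\|\to+\infty}\|x+\lambda T(x)\|=+\infty\quad\text{for all }\lambda>\lambda_0 .$$ Set $$\Gamma=\{(x,y)\in X\times X:\langle T'(x)(y),y\rangle<0\}$$ and, for each $\mu\in\mathbb{R}$, $$A_\mu=\{x\in X: T'(x)(y)=\mu y\ \text{for some } y\in X\setminus\{0\}\}.$$ When $\Gamma\ne\emptyset$, set also $$\tilde\mu=\max\left\{-\frac{1}{\lambda_0},\ \inf_{(x,y)\in\Gamma}\frac{\langle T'(x)(y),y\rangle}{\|y\|^2}\right\},$$ where $-\frac{1}{\lambda_0}$ is read as $-\infty$ if $\lambda_0=0$. Then the following assertions are equivalent: (i) the operator $T$ is not monotone; (ii) there exists $\mu<0$ such that $A_\mu\ne\emptyset$; (iii) $\Gamma\ne\emptyset$ and, for each $\mu\in\,]\tilde\mu,0[$, the set $A_\mu$ contains an accumulation point (that is, some point of $A_\mu$ is an accumulation point of $A_\mu$).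
   Context: A continuous operator $T:X\to X$ (with $X\cong X^*$ via the inner product) is a potential operator if the functional $J_T(x)=\int_0^1\langle T(sx),x\rangle\,ds$ is of class $C^1$ on $X$ and its Gâteaux derivative (gradient) is equal to $T$. $T$ is monotone if $\langle T(x)-T(y),x-y\rangle\ge 0$ for all $x,y\in X$. $T$ is compact if for each bounded set $B\subset X$ the closure $\overline{T(B)}$ is compact. $]\tilde\mu,0[$ denotes the open interval with endpoints $\tilde\mu$ and $0$; $\tilde\mu$ may be $-\infty$. *)

theory Defs
  imports "HOL-Analysis.Analysis"
begin

text \<open>Continuous Frechet differentiability on the whole space, the derivative being continuous
  in the operator norm.\<close>

definition class_C1 :: "('a::real_normed_vector \<Rightarrow> 'b::real_normed_vector) \<Rightarrow> bool" where
  "class_C1 f \<longleftrightarrow>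
    (\<exists>f' :: 'a \<Rightarrow> 'a \<Rightarrow>\<^sub>L 'b. (\<forall>x. (f has_derivative blinfun_apply (f' x)) (at x)) \<and> continuous_on UNIV f')"

definition has_gateaux_gradient :: "('a::real_inner \<Rightarrow> real) \<Rightarrow> 'a \<Rightarrow> 'a \<Rightarrow> bool" where
  "has_gateaux_gradient f g x \<longleftrightarrow>
    (\<forall>v. ((\<lambda>t. f (x + t *\<^sub>R v)) has_real_derivative (g \<bullet> v)) (at 0))"

definition J_fun :: "('a::real_inner \<Rightarrow> 'a) \<Rightarrow> 'a \<Rightarrow> real" where
  "J_fun T x = integral {0..1} (\<lambda>s. T (s *\<^sub>R x) \<bullet> x)"

definition potential_operator :: "('a::real_inner \<Rightarrow> 'a) \<Rightarrow> bool" where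
  "potential_operator T \<longleftrightarrow>
    continuous_on UNIV T \<and> class_C1 (J_fun T) \<and> (\<forall>x. has_gateaux_gradient (J_fun T) (T x) x)"

definition monotone_operator :: "('a::real_inner \<Rightarrow> 'a) \<Rightarrow> bool" where
  "monotone_operator T \<longleftrightarrow> (\<forall>x y. (T x - T y) \<bullet> (x - y) \<ge> 0)"

definition compact_operator :: "('a::real_normed_vector \<Rightarrow> 'a) \<Rightarrow> bool" where
  "compact_operator T \<longleftrightarrow> (\<forall>B. bounded B \<longrightarrow> compact (closure (T ` B)))"

definition Gamma_set :: "('a::real_inner \<Rightarrow> 'a) \<Rightarrow> ('a \<times> 'a) set" where
  "Gamma_set T = {(x, y). frechet_derivative T (at x) y \<bullet> y < 0}"

definition A_set :: "('a::real_normed_vector \<Rightarrow> 'a) \<Rightarrow> real \<Rightarrow> 'a set" where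
  "A_set T \<mu> = {x. \<exists>y. y \<noteq> 0 \<and> frechet_derivative T (at x) y = \<mu> *\<^sub>R y}"

text \<open>Extended-real valued, because both terms of the maximum may be \<open>-\<infinity>\<close>. Only meaningful
  when \<open>Gamma_set T\<close> is nonempty.\<close>

definition mu_tilde :: "('a::real_inner \<Rightarrow> 'a) \<Rightarrow> real \<Rightarrow> ereal" where
  "mu_tilde T lam0 =
    max (if lam0 = 0 then -\<infinity> else ereal (- (1 / lam0)))
        (INF (x, y)\<in>Gamma_set T. ereal ((frechet_derivative T (at x) y \<bullet> y) / (norm y)\<^sup>2))"

end

theory Submission
  imports Defs
begin

text \<open>For \<open>\<mu> < 0\<close> let \<open>H x = T' x - \<mu> I\<close>, a self-adjoint compact perturbation of \<open>- \<mu> I\<close>; it is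
  singular exactly on \<open>A_\<mu>\<close>, which is therefore closed, and where it is positive semidefinite and
  nonsingular it is positive definite, hence stays positive definite nearby. Suppose that
  \<open>A_\<mu>\<close> has no accumulation point. The functionals
  \<open>J x - \<mu> \<parallel>x\<parallel>\<^sup>2 / 2 - \<langle>y, x\<rangle>\<close> have Hessian \<open>H\<close> and, by Ekeland's principle, compactness and the growth
  condition, a global minimizer for every \<open>y\<close>. Letting \<open>y \<rightarrow> 0\<close> through distinct values, the minimizers
  are distinct and subconverge, so one of them, \<open>a\<close>, lies outside \<open>A_\<mu>\<close>, and
  \<open>H a\<close> is positive definite. As \<open>A_\<mu>\<close> is closed and discrete, segments from \<open>a\<close> avoiding it reach points
  arbitrarily near any given point, so by connectedness \<open>H \<ge> 0\<close> everywhere. This contradicts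
  \<open>\<langle>T' x\<^sub>0 y\<^sub>0, y\<^sub>0\<rangle> < \<mu> \<parallel>y\<^sub>0\<parallel>\<^sup>2\<close>, which some \<open>(x\<^sub>0, y\<^sub>0) \<in> \<Gamma>\<close> satisfies when \<open>\<mu>\<close> exceeds the infimum over \<open>\<Gamma>\<close>.\<close>

section \<open>Ekeland's variational principle\<close>

text \<open>Repeatedly jumping to a near-minimizer of \<open>f\<close> over the nested sets
  \<open>S\<close> gives a Cauchy sequence, because each distance, scaled by \<open>e\<close>, is
  paid for by a drop in the bounded-below values of \<open>f\<close>. From the limit no further gain
  can exceed \<open>e\<close> times the distance travelled.\<close>

lemma ekeland:
  fixes f :: "'a::complete_space \<Rightarrow> real"
  assumes cont: "continuous_on UNIV f" and bdd: "\<And>x. c \<le> f x" and e: "e > 0"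
  shows "\<exists>x. \<forall>z. f x \<le> f z + e * dist x z"
proof -
  \<comment> \<open>Points whose value undercuts \<open>f x\<close> by at least \<open>e\<close>
    times their distance from \<open>x\<close>. The triangle inequality makes this relation
    transitive, so the sets shrink along the sequence.\<close>
  define S where "S x = {z. f z + e * dist x z \<le> f x}" for x
  have S_self: "x \<in> S x" for x by (simp add: S_def)
  have S_trans: "S z \<subseteq> S x" if "z \<in> S x" for x z
  proof
    fix w assume w: "w \<in> S z"
    have "e * dist x w \<le> e * (dist x z + dist z w)"
      using e by (intro mult_left_mono dist_triangle) auto
    with w that show "w \<in> S x" by (simp add: S_def algebra_simps)
  qed
  have bb: "bdd_below (f ` A)" for A using bdd by (auto intro!: bdd_belowI)
  \<comment> \<open>The infimum need not be attained, hence a tolerance that vanishes with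
    \<open>n\<close>.\<close>
  have "\<exists>z. z \<in> S x \<and> f z \<le> Inf (f ` S x) + inverse (real (Suc n))" for x n
  proof -
    have "Inf (f ` S x) < Inf (f ` S x) + inverse (real (Suc n))" by simp
    then have "\<exists>y\<in>f ` S x. y < Inf (f ` S x) + inverse (real (Suc n))"
      using S_self[of x] cInf_less_iff[OF _ bb] by blast
    then show ?thesis by (auto intro: less_imp_le)
  qed
  then have "\<exists>X. \<forall>n. X (Suc n) \<in> S (X n) \<and>
      f (X (Suc n)) \<le> Inf (f ` S (X n)) + inverse (real (Suc n))"
    using dependent_nat_choice[of "\<lambda>_ _. True"
      "\<lambda>n x z. z \<in> S x \<and> f z \<le> Inf (f ` S x) + inverse (real (Suc n))"] by simp
  then obtain X where X: "\<And>n. X (Suc n) \<in> S (X n)"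
      "\<And>n. f (X (Suc n)) \<le> Inf (f ` S (X n)) + inverse (real (Suc n))" by blast
  have nest: "X n \<in> S (X m)" if "m \<le> n" for m n
    using that
  proof (induction rule: dec_induct)
    case base show ?case by (rule S_self)
  next
    case (step n) then show ?case using X(1) S_trans by blast
  qed
  have mono: "f (X n) \<le> f (X m)" if "m \<le> n" for m n
  proof -
    have "0 \<le> e * dist (X m) (X n)" using e by simp
    then show ?thesis using nest[OF that] unfolding S_def mem_Collect_eq by linarith
  qed
  have "decseq (\<lambda>n. f (X n))" using mono by (simp add: decseq_def)
  then obtain L where "(\<lambda>n. f (X n)) \<longlonglongrightarrow> L" using decseq_convergent[of _ c] bdd by metis
  then have "Cauchy (\<lambda>n. f (X n))" by (rule LIMSEQ_imp_Cauchy)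
  have "Cauchy X"
  proof (rule metric_CauchyI)
    fix r :: real assume "r > 0"
    with e \<open>Cauchy (\<lambda>n. f (X n))\<close> obtain N where
      N: "\<And>m n. m \<ge> N \<Longrightarrow> n \<ge> N \<Longrightarrow> dist (f (X m)) (f (X n)) < e * r"
      by (metis metric_CauchyD mult_pos_pos)
    have A: "dist (X m) (X n) < r" if "m \<ge> N" "m \<le> n" for m n
    proof -
      have "e * dist (X m) (X n) \<le> f (X m) - f (X n)"
        using nest[OF that(2)] by (simp add: S_def)
      also have "\<dots> < e * r" using N[of m n] that by (simp add: dist_real_def)
      finally show ?thesis using e by simp
    qed
    then show "\<exists>M. \<forall>m\<ge>M. \<forall>n\<ge>M. dist (X m) (X n) < r"
      by (metis dist_commute nle_le)
  qed
  then obtain x where lim: "X \<longlonglongrightarrow> x" by (metis Cauchy_convergent convergent_def)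
  have isc: "isCont f w" for w using cont by (simp add: continuous_on_eq_continuous_at)
  have flim: "(\<lambda>n. f (X n)) \<longlonglongrightarrow> f x" using isCont_tendsto_compose[OF isc lim] .
  have xS: "x \<in> S (X n)" for n
  proof -
    have "(\<lambda>k. f (X k) + e * dist (X n) (X k)) \<longlonglongrightarrow> f x + e * dist (X n) x"
      by (intro tendsto_intros flim lim)
    moreover have "\<forall>k\<ge>n. f (X k) + e * dist (X n) (X k) \<le> f (X n)"
      using nest by (auto simp: S_def)
    ultimately show ?thesis unfolding S_def by (auto intro: LIMSEQ_le_const2)
  qed
  have "f x \<le> f z + e * dist x z" for z
  proof (rule ccontr)
    assume "\<not> ?thesis"
    then have z: "z \<in> S x" and less: "f x > f z + e * dist x z" by (auto simp: S_def)
    \<comment> \<open>Such a \<open>z\<close> lies in every \<open>S (X n)\<close> and so competes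
      in every infimum.\<close>
    have "f (X (Suc n)) \<le> f z + inverse (real (Suc n))" for n
    proof -
      have "Inf (f ` S (X n)) \<le> f z" using S_trans[OF xS] z by (intro cInf_lower bb) blast
      then show ?thesis using X(2)[of n] by simp
    qed
    moreover have "(\<lambda>n. f z + inverse (real (Suc n))) \<longlonglongrightarrow> f z + 0"
      by (intro tendsto_intros LIMSEQ_inverse_real_of_nat)
    ultimately have "f x \<le> f z + 0" using LIMSEQ_Suc[OF flim] by (blast intro: LIMSEQ_le)
    moreover have "e * dist x z \<ge> 0" using e by simp
    ultimately show False using less by simp
  qed
  then show ?thesis by blast
qed

section \<open>Accumulation points, and segments avoiding a set without them\<close>

lemma islimpt_inj_sequence:
  fixes X :: "nat \<Rightarrow> 'a::metric_space"
  assumes "inj X" "\<And>n. X n \<in> S" "X \<longlonglongrightarrow> l"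
  shows "l islimpt S"
  unfolding islimpt_eq_infinite_ball
proof (intro allI impI)
  fix e :: real assume "e > 0"
  then obtain N where N: "\<And>n. n \<ge> N \<Longrightarrow> dist (X n) l < e"
    using assms(3) by (auto simp: lim_sequentially)
  have "X ` {N..} \<subseteq> S \<inter> ball l e" using N assms(2) by (auto simp: dist_commute)
  moreover have "infinite (X ` {N..})"
    using assms(1) by (metis finite_imageD infinite_Ici inj_on_subset subset_UNIV)
  ultimately show "infinite (S \<inter> ball l e)" using finite_subset by blast
qed

text \<open>The segments from \<open>a\<close> to the points \<open>b + t v\<close> meet only in \<open>a\<close>, so if all of them met \<open>S\<close>
  then \<open>S\<close> would have infinitely many points in a compact subset of a plane.\<close>

lemma closed_segment_avoiding:
  fixes S :: "'a::real_normed_vector set"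
  assumes nolim: "\<And>x. \<not> x islimpt S" and a: "a \<notin> S" and ab: "a \<noteq> b"
    and v: "v \<notin> span {b - a}" and r: "r > 0"
  shows "\<exists>t. 0 < t \<and> t < r \<and> closed_segment a (b + t *\<^sub>R v) \<inter> S = {}"
proof (rule ccontr)
  assume neg: "\<not> ?thesis"
  \<comment> \<open>The double \<open>Suc\<close> makes \<open>t 0\<close> equal to
    \<open>r / 2\<close>, strictly below \<open>r\<close>.\<close>
  define t where "t n = r * inverse (real (Suc (Suc n)))" for n
  have t: "0 < t n" "t n < r" for n using r by (auto simp: t_def field_simps add_pos_nonneg)
  have "\<exists>u. 0 \<le> u \<and> u \<le> 1 \<and> (1 - u) *\<^sub>R a + u *\<^sub>R (b + t n *\<^sub>R v) \<in> S" for n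
    using neg t[of n] unfolding closed_segment_def by blast
  then obtain u where u: "\<And>n. 0 \<le> u n" "\<And>n. u n \<le> 1"
    and uS: "\<And>n. (1 - u n) *\<^sub>R a + u n *\<^sub>R (b + t n *\<^sub>R v) \<in> S" by metis
  define X where "X n = (1 - u n) *\<^sub>R a + u n *\<^sub>R (b + t n *\<^sub>R v)" for n
  have "inj X"
  proof (rule injI)
    fix n k assume "X n = X k"
    then have eq: "(u n * t n - u k * t k) *\<^sub>R v = (u k - u n) *\<^sub>R (b - a)"
      by (simp add: X_def algebra_simps)
    \<comment> \<open>Independence of \<open>v\<close> and \<open>b - a\<close> makes both
      coefficients in \<open>eq\<close> vanish. Then \<open>u n = u k\<close> is nonzero,
      \<open>a\<close> being outside \<open>S\<close>, so the values of \<open>t\<close> agree as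
      well.\<close>
    have "u n * t n = u k * t k"
    proof (rule ccontr)
      assume ne: "u n * t n \<noteq> u k * t k"
      have "v = inverse (u n * t n - u k * t k) *\<^sub>R (u n * t n - u k * t k) *\<^sub>R v"
        using ne by simp
      also have "\<dots> \<in> span {b - a}" unfolding eq by (intro span_scale span_base) simp
      finally show False using v by simp
    qed
    moreover from this eq ab have "u n = u k" by simp
    moreover have "u n \<noteq> 0" using uS[of n] a by auto
    ultimately have "t n = t k" by simp
    then show "n = k" using r by (simp add: t_def field_simps)
  qed
  obtain l q where q: "strict_mono (q :: nat \<Rightarrow> nat)" and l: "(u \<circ> q) \<longlonglongrightarrow> l"
    using compact_Icc[of "0::real" 1, unfolded compact_def] u by (metis atLeastAtMost_iff)
  have "t \<longlonglongrightarrow> r * 0"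
    unfolding t_def by (intro tendsto_intros LIMSEQ_Suc[OF LIMSEQ_inverse_real_of_nat])
  then have "(t \<circ> q) \<longlonglongrightarrow> 0" using q unfolding mult_zero_right by (rule LIMSEQ_subseq_LIMSEQ)
  with l have "(\<lambda>n. (1 - (u \<circ> q) n) *\<^sub>R a + (u \<circ> q) n *\<^sub>R (b + (t \<circ> q) n *\<^sub>R v))
      \<longlonglongrightarrow> (1 - l) *\<^sub>R a + l *\<^sub>R (b + 0 *\<^sub>R v)"
    by (intro tendsto_intros)
  then have "(X \<circ> q) \<longlonglongrightarrow> (1 - l) *\<^sub>R a + l *\<^sub>R (b + 0 *\<^sub>R v)"
    by (simp add: X_def o_def)
  moreover have "inj (X \<circ> q)" using \<open>inj X\<close> q strict_mono_imp_inj_on inj_compose by blast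
  moreover have "(X \<circ> q) n \<in> S" for n using uS by (simp add: X_def)
  ultimately show False using islimpt_inj_sequence nolim by blast
qed

section \<open>Compactness of the derivative and its eigenvectors\<close>

text \<open>Compactness makes \<open>D (v n)\<close> converge along a subsequence. As \<mu> is
  nonzero, \<open>v n\<close> is recovered from \<open>D (v n)\<close> and the vanishing residual,
  so it converges too, and its limit keeps norm 1.\<close>

lemma approx_eigenvector_limit:
  fixes D :: "'a::real_normed_vector \<Rightarrow>\<^sub>L 'a"
  assumes cpt: "compact (closure (blinfun_apply D ` cball 0 1))" and "\<mu> \<noteq> 0"
    and norm: "\<And>n::nat. norm (v n) = 1" and lim: "(\<lambda>n. D (v n) - \<mu> *\<^sub>R v n) \<longlonglongrightarrow> 0"
  shows "\<exists>w. w \<noteq> 0 \<and> D w = \<mu> *\<^sub>R w"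
proof -
  have "\<forall>n. D (v n) \<in> closure (blinfun_apply D ` cball 0 1)"
    using norm by (intro allI closure_subset[THEN subsetD] imageI) simp
  then obtain l q where q: "strict_mono (q :: nat \<Rightarrow> nat)" and l: "((\<lambda>n. D (v n)) \<circ> q) \<longlonglongrightarrow> l"
    using cpt[unfolded compact_def] by metis
  have "(\<lambda>n. D (v (q n))) \<longlonglongrightarrow> l" using l by (simp add: o_def)
  moreover have "(\<lambda>n. D (v (q n)) - \<mu> *\<^sub>R v (q n)) \<longlonglongrightarrow> 0"
    using LIMSEQ_subseq_LIMSEQ[OF lim q] by (simp add: o_def)
  ultimately have "(\<lambda>n. inverse \<mu> *\<^sub>R (D (v (q n)) - (D (v (q n)) - \<mu> *\<^sub>R v (q n))))
      \<longlonglongrightarrow> inverse \<mu> *\<^sub>R (l - 0)"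
    by (intro tendsto_intros)
  then have vlim: "(\<lambda>n. v (q n)) \<longlonglongrightarrow> inverse \<mu> *\<^sub>R l" using \<open>\<mu> \<noteq> 0\<close> by simp
  have "(\<lambda>n. norm (v (q n))) \<longlonglongrightarrow> norm (inverse \<mu> *\<^sub>R l)"
    using vlim by (rule tendsto_norm)
  then have "norm (inverse \<mu> *\<^sub>R l) = 1" using norm by (simp add: LIMSEQ_const_iff)
  moreover have "D (inverse \<mu> *\<^sub>R l) = l"
  proof (rule LIMSEQ_unique)
    show "(\<lambda>n. D (v (q n))) \<longlonglongrightarrow> D (inverse \<mu> *\<^sub>R l)"
      by (intro tendsto_intros vlim)
  qed fact
  ultimately show ?thesis using \<open>\<mu> \<noteq> 0\<close>
    by (intro exI[of _ "inverse \<mu> *\<^sub>R l"]) auto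
qed

text \<open>On the unit ball \<open>D v\<close> is a uniform limit of difference quotients of
  \<open>T\<close>, so a finite net for the values of \<open>T\<close> near \<open>x\<close>
  rescales to one for the values of \<open>D\<close>. Total boundedness and completeness then give
  compactness.\<close>

lemma compact_derivative:
  fixes T :: "'a::real_normed_vector \<Rightarrow> 'b::{real_normed_vector, complete_space}"
  assumes cpt: "compact (closure (T ` cball x 1))"
    and der: "(T has_derivative D) (at x)"
  shows "compact (closure (D ` cball 0 1))"
proof -
  interpret D: bounded_linear D using der by (rule has_derivative_bounded_linear)
  have "\<exists>k. finite k \<and> closure (D ` cball 0 1) \<subseteq> (\<Union>z\<in>k. ball z e)" if "e > 0" for e
  proof -
    have "e / 4 > 0" using that by simp
    then obtain d where d: "d > 0"
      and dd: "\<And>y. norm (y - x) < d \<Longrightarrow> norm (T y - T x - D (y - x)) \<le> e / 4 * norm (y - x)"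
      using der unfolding has_derivative_at_alt by blast
    \<comment> \<open>At most 1 to stay in the ball on which \<open>cpt\<close> is assumed, and
      below \<open>d\<close> for the linearization estimate.\<close>
    define h where "h = min 1 (d / 2)"
    have h: "0 < h" "h \<le> 1" "h < d" using d by (auto simp: h_def)
    have approx: "norm (T (x + h *\<^sub>R v) - T x - h *\<^sub>R D v) \<le> e / 4 * h" if "norm v \<le> 1" for v
    proof -
      have "norm (h *\<^sub>R v) \<le> h" using that h by (simp add: mult_left_le)
      then have "norm (h *\<^sub>R v) < d" using h by linarith
      then have "norm (T (x + h *\<^sub>R v) - T x - D (h *\<^sub>R v)) \<le> e / 4 * norm (h *\<^sub>R v)"
        using dd[of "x + h *\<^sub>R v"] by simp
      also have "\<dots> \<le> e / 4 * h" using \<open>e > 0\<close> \<open>norm (h *\<^sub>R v) \<le> h\<close> by simp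
      finally show ?thesis by (simp add: D.scaleR)
    qed
    have "e / 4 * h > 0" using \<open>e > 0\<close> h by simp
    \<comment> \<open>The radius carries a factor \<open>h\<close> because the net is divided by
      \<open>h\<close> afterwards. Net and linearization errors then add up to \<open>e / 2\<close>;
      the slack up to \<open>e\<close> permits closed balls, whose finite union also contains the
      closure.\<close>
    then obtain k where k: "finite k" "closure (T ` cball x 1) \<subseteq> (\<Union>z\<in>k. ball z (e / 4 * h))"
      using cpt unfolding compact_eq_totally_bounded by blast
    define k' where "k' = (\<lambda>z. inverse h *\<^sub>R (z - T x)) ` k"
    have "D ` cball 0 1 \<subseteq> (\<Union>z\<in>k'. cball z (e / 2))"
    proof
      fix w assume "w \<in> D ` cball 0 1"
      then obtain v where v: "norm v \<le> 1" "w = D v" by auto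
      have "norm (h *\<^sub>R v) \<le> 1" using v h by (simp add: mult_le_one)
      then have "T (x + h *\<^sub>R v) \<in> closure (T ` cball x 1)"
        by (intro closure_subset[THEN subsetD] imageI) (simp add: dist_norm)
      then obtain z where z: "z \<in> k" "dist z (T (x + h *\<^sub>R v)) < e / 4 * h" using k by auto
      have eq: "z - T x - h *\<^sub>R D v
          = (z - T (x + h *\<^sub>R v)) + (T (x + h *\<^sub>R v) - T x - h *\<^sub>R D v)" by simp
      have "norm (z - T x - h *\<^sub>R D v) \<le> e / 4 * h + e / 4 * h"
        unfolding eq using approx[OF v(1)] z(2)
        by (intro norm_triangle_mono) (auto simp: dist_norm)
      then have "inverse h * norm (z - T x - h *\<^sub>R D v) \<le> inverse h * (e / 4 * h + e / 4 * h)"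
        using h by (intro mult_left_mono) auto
      also have "\<dots> = e / 2" using h by (simp add: field_simps)
      also have "inverse h * norm (z - T x - h *\<^sub>R D v)
          = norm (inverse h *\<^sub>R (z - T x - h *\<^sub>R D v))" using h by simp
      also have "inverse h *\<^sub>R (z - T x - h *\<^sub>R D v) = inverse h *\<^sub>R (z - T x) - w"
        using h v by (simp add: scaleR_diff_right)
      finally show "w \<in> (\<Union>z\<in>k'. cball z (e / 2))"
        using z(1) by (auto simp: k'_def dist_norm)
    qed
    moreover have fin: "finite k'" using k by (simp add: k'_def)
    ultimately have "closure (D ` cball 0 1) \<subseteq> (\<Union>z\<in>k'. cball z (e / 2))"
      by (intro closure_minimal closed_UN) auto
    also have "\<dots> \<subseteq> (\<Union>z\<in>k'. ball z e)" using \<open>e > 0\<close> by auto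
    finally show ?thesis using fin by blast
  qed
  then show ?thesis by (simp add: compact_eq_totally_bounded complete_eq_closed)
qed

section \<open>Symmetry of the second derivative\<close>

text \<open>The mean value theorem in the direction \<open>u\<close> turns the second difference
  into \<open>h\<close> times the \<open>u\<close> component of an increment of \<open>T\<close> in
  the direction \<open>v\<close>, which is \<open>h *\<^sub>R D v\<close> up to an error small
  compared with \<open>h\<close>.\<close>

lemma second_difference_estimate:
  fixes T :: "'a::real_inner \<Rightarrow> 'a"
  assumes J: "\<And>x. (J has_derivative (\<lambda>v. T x \<bullet> v)) (at x)"
    and der: "(T has_derivative D) (at x)" and e: "e > 0"
  shows "\<exists>d>0. \<forall>h. 0 < h \<and> h < d \<longrightarrow>
    \<bar>J (x + h *\<^sub>R u + h *\<^sub>R v) - J (x + h *\<^sub>R u) - J (x + h *\<^sub>R v) + J x - h\<^sup>2 * (D v \<bullet> u)\<bar> \<le> e * h\<^sup>2"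
proof -
  interpret D: bounded_linear D using der by (rule has_derivative_bounded_linear)
  define M where "M = norm u + norm v + 1"
  have M: "M \<ge> 1" "norm u \<le> M" "norm v \<le> M" "norm u + norm v \<le> M" by (auto simp: M_def)
  \<comment> \<open>Makes the final bound exactly \<open>e * h\<^sup>2\<close>: the 2 counts the
    remainders \<open>p\<close> and \<open>q\<close>, one \<open>M\<close> bounds the displacement
    and the other \<open>norm u\<close>.\<close>
  define e' where "e' = e / (2 * M * M)"
  have "e' > 0" using e M by (simp add: e'_def)
  then obtain d where d: "d > 0"
      and dd: "\<And>y. norm (y - x) < d \<Longrightarrow> norm (T y - T x - D (y - x)) \<le> e' * norm (y - x)"
      using der unfolding has_derivative_at_alt by blast
  have "\<bar>J (x + h *\<^sub>R u + h *\<^sub>R v) - J (x + h *\<^sub>R u) - J (x + h *\<^sub>R v) + J x - h\<^sup>2 * (D v \<bullet> u)\<bar> \<le> e * h\<^sup>2"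
    if h: "0 < h" "h < d / M" for h
  proof -
    define g where "g t = J (x + t *\<^sub>R u + h *\<^sub>R v) - J (x + t *\<^sub>R u)" for t
    have "(g has_derivative (\<lambda>s. T (x + t *\<^sub>R u + h *\<^sub>R v) \<bullet> (s *\<^sub>R u) - T (x + t *\<^sub>R u) \<bullet> (s *\<^sub>R u))) (at t)" for t
      unfolding g_def
      by (intro has_derivative_diff has_derivative_compose[OF _ J]) (auto intro!: derivative_eq_intros)
    then have gd: "(g has_real_derivative ((T (x + t *\<^sub>R u + h *\<^sub>R v) - T (x + t *\<^sub>R u)) \<bullet> u)) (at t)" for t
      by (rule has_derivative_imp_has_field_derivative) (simp add: inner_diff_left algebra_simps)
    obtain t where t: "0 < t" "t < h"
      and mvt: "g h - g 0 = (h - 0) * ((T (x + t *\<^sub>R u + h *\<^sub>R v) - T (x + t *\<^sub>R u)) \<bullet> u)"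
      using MVT2[OF h(1) gd] by blast
    have hM: "h * M < d" using h M by (simp add: field_simps)
    have n1: "norm (t *\<^sub>R u + h *\<^sub>R v) \<le> h * M"
    proof -
      have "norm (t *\<^sub>R u + h *\<^sub>R v) \<le> t * norm u + h * norm v"
        using t h by (intro order_trans[OF norm_triangle_ineq]) simp
      also have "\<dots> \<le> h * (norm u + norm v)" using t by (simp add: algebra_simps mult_right_mono)
      also have "\<dots> \<le> h * M" using M h by simp
      finally show ?thesis .
    qed
    have n2: "norm (t *\<^sub>R u) \<le> h * M" using t h M by (simp add: mult_mono)
    define p where "p = T (x + t *\<^sub>R u + h *\<^sub>R v) - T x - D (t *\<^sub>R u + h *\<^sub>R v)"
    define q where "q = T (x + t *\<^sub>R u) - T x - D (t *\<^sub>R u)"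
    have "norm p \<le> e' * (h * M)"
    proof -
      have "norm p \<le> e' * norm (t *\<^sub>R u + h *\<^sub>R v)"
        unfolding p_def using dd[of "x + t *\<^sub>R u + h *\<^sub>R v"] n1 hM by (simp add: add.assoc)
      also have "\<dots> \<le> e' * (h * M)" using n1 \<open>e' > 0\<close> by simp
      finally show ?thesis .
    qed
    moreover have "norm q \<le> e' * (h * M)"
    proof -
      have "norm q \<le> e' * norm (t *\<^sub>R u)"
        unfolding q_def using dd[of "x + t *\<^sub>R u"] n2 hM by simp
      also have "\<dots> \<le> e' * (h * M)" using n2 \<open>e' > 0\<close> by simp
      finally show ?thesis .
    qed
    ultimately have pq: "norm (p - q) \<le> 2 * e' * (h * M)"
      using norm_triangle_ineq4[of p q] by linarith
    \<comment> \<open>Both values of \<open>T\<close> are expanded about \<open>x\<close>, so the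
      contributions \<open>D (t *\<^sub>R u)\<close> cancel.\<close>
    have eq: "T (x + t *\<^sub>R u + h *\<^sub>R v) - T (x + t *\<^sub>R u) = (p - q) + h *\<^sub>R D v"
      by (simp add: p_def q_def D.add D.scaleR)
    have "g h - g 0 - h\<^sup>2 * (D v \<bullet> u) = h * ((p - q) \<bullet> u)"
      unfolding mvt eq by (simp add: inner_add_left power2_eq_square algebra_simps)
    also have "\<bar>\<dots>\<bar> \<le> h * (norm (p - q) * norm u)"
      using h by (simp add: abs_mult Cauchy_Schwarz_ineq2)
    also have "\<dots> \<le> h * ((2 * e' * (h * M)) * M)"
      using h pq M \<open>e' > 0\<close> by (intro mult_left_mono mult_mono) auto
    also have "\<dots> = e * h\<^sup>2" using M by (simp add: e'_def power2_eq_square field_simps)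
    finally show ?thesis by (simp add: g_def algebra_simps)
  qed
  then show ?thesis using d M by (intro exI[of _ "d / M"]) auto
qed

text \<open>The second difference of \<open>J\<close> does not change when \<open>u\<close> and
  \<open>v\<close> are exchanged, so its two expansions agree up to \<open>e * h\<^sup>2\<close> for
  every positive \<open>e\<close>.\<close>

lemma gradient_derivative_symmetric:
  fixes T :: "'a::real_inner \<Rightarrow> 'a"
  assumes J: "\<And>x. (J has_derivative (\<lambda>v. T x \<bullet> v)) (at x)"
    and der: "(T has_derivative D) (at x)"
  shows "D u \<bullet> v = u \<bullet> D v"
proof -
  have "\<bar>D u \<bullet> v - D v \<bullet> u\<bar> \<le> e" if "e > 0" for e
  proof -
    have "e / 2 > 0" using that by simp
    obtain d1 where d1: "d1 > 0" "\<And>h. 0 < h \<Longrightarrow> h < d1 \<Longrightarrow>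
        \<bar>J (x + h *\<^sub>R u + h *\<^sub>R v) - J (x + h *\<^sub>R u) - J (x + h *\<^sub>R v) + J x - h\<^sup>2 * (D v \<bullet> u)\<bar> \<le> e / 2 * h\<^sup>2"
      using second_difference_estimate[OF J der \<open>e / 2 > 0\<close>, of u v] by blast
    obtain d2 where d2: "d2 > 0" "\<And>h. 0 < h \<Longrightarrow> h < d2 \<Longrightarrow>
        \<bar>J (x + h *\<^sub>R v + h *\<^sub>R u) - J (x + h *\<^sub>R v) - J (x + h *\<^sub>R u) + J x - h\<^sup>2 * (D u \<bullet> v)\<bar> \<le> e / 2 * h\<^sup>2"
      using second_difference_estimate[OF J der \<open>e / 2 > 0\<close>, of v u] by blast
    define h where "h = min d1 d2 / 2"
    have h: "0 < h" "h < d1" "h < d2" using d1 d2 by (auto simp: h_def)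
    have swap: "x + h *\<^sub>R v + h *\<^sub>R u = x + h *\<^sub>R u + h *\<^sub>R v" by simp
    have "\<bar>h\<^sup>2 * (D u \<bullet> v) - h\<^sup>2 * (D v \<bullet> u)\<bar> \<le> e * h\<^sup>2"
      using d1(2)[OF h(1,2)] d2(2)[OF h(1,3), unfolded swap] by argo
    moreover have "h\<^sup>2 * (D u \<bullet> v) - h\<^sup>2 * (D v \<bullet> u) = h\<^sup>2 * (D u \<bullet> v - D v \<bullet> u)"
      by (simp only: right_diff_distrib)
    ultimately have "h\<^sup>2 * \<bar>D u \<bullet> v - D v \<bullet> u\<bar> \<le> h\<^sup>2 * e"
      by (simp add: abs_mult mult.commute)
    then show ?thesis using h by simp
  qed
  then have "D u \<bullet> v = D v \<bullet> u"
    using field_le_epsilon[of "\<bar>D u \<bullet> v - D v \<bullet> u\<bar>" 0] by simp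
  then show ?thesis by (simp add: inner_commute)
qed

section \<open>Positive semidefinite and positive definite operators\<close>

text \<open>Testing positivity at \<open>v - t *\<^sub>R A v\<close> amounts to a Cauchy-Schwarz
  argument for the form of \<open>A\<close>. The purpose is to conclude that \<open>A v\<close> is
  small as soon as \<open>A v \<bullet> v\<close> is.\<close>

lemma semidefinite_norm_bound:
  fixes A :: "'a::real_inner \<Rightarrow>\<^sub>L 'a"
  assumes sym: "\<And>u v. A u \<bullet> v = u \<bullet> A v" and psd: "\<And>v. A v \<bullet> v \<ge> 0"
  shows "(norm (A v))\<^sup>2 \<le> (norm A + 1) * (A v \<bullet> v)"
proof -
  \<comment> \<open>With this \<open>t\<close> the quadratic term absorbs at most half of the linear
    one; adding 1 covers \<open>A = 0\<close>.\<close>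
  define t where "t = inverse (norm A + 1)"
  have t: "t > 0" "t * (norm A + 1) = 1" using norm_ge_zero[of A]
    by (auto simp: t_def field_simps add_pos_nonneg simp del: norm_ge_zero)
  have "A (A v) \<bullet> A v \<le> norm (A (A v)) * norm (A v)" by (rule norm_cauchy_schwarz)
  also have "\<dots> \<le> (norm A * norm (A v)) * norm (A v)"
    by (intro mult_right_mono norm_blinfun norm_ge_zero)
  also have "\<dots> \<le> (norm A + 1) * (norm (A v))\<^sup>2" by (simp add: power2_eq_square algebra_simps)
  finally have q: "A (A v) \<bullet> A v \<le> (norm A + 1) * (norm (A v))\<^sup>2" .
  have "0 \<le> A (v - t *\<^sub>R A v) \<bullet> (v - t *\<^sub>R A v)" by (rule psd)
  also have "\<dots> = A v \<bullet> v - 2 * t * (norm (A v))\<^sup>2 + t * (t * (A (A v) \<bullet> A v))"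
    using sym[of "A v" v]
    by (simp add: blinfun.diff_right blinfun.scaleR_right inner_diff_left inner_diff_right
        power2_norm_eq_inner algebra_simps)
  also have "\<dots> \<le> A v \<bullet> v - 2 * t * (norm (A v))\<^sup>2 + t * (t * ((norm A + 1) * (norm (A v))\<^sup>2))"
    using q t by simp
  also have "t * (t * ((norm A + 1) * (norm (A v))\<^sup>2)) = (t * (norm A + 1)) * (t * (norm (A v))\<^sup>2)"
    by (simp only: ac_simps)
  also have "\<dots> = t * (norm (A v))\<^sup>2" by (simp add: t)
  finally have "t * (norm (A v))\<^sup>2 \<le> A v \<bullet> v" by simp
  then have "(norm A + 1) * (t * (norm (A v))\<^sup>2) \<le> (norm A + 1) * (A v \<bullet> v)"
    by (intro mult_left_mono) auto
  then show ?thesis using t by (simp add: mult.assoc[symmetric] mult.commute)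
qed

text \<open>If every \<open>c\<close> fails, there are unit vectors along which the form of
  \<open>A\<close> tends to 0. By \<open>semidefinite_norm_bound\<close> they are approximate
  eigenvectors, and compactness yields a genuine one, excluded by \<open>inj\<close>.\<close>

lemma positive_definite_of_semidefinite:
  fixes D :: "'a::real_inner \<Rightarrow>\<^sub>L 'a"
  assumes sym: "\<And>u v. D u \<bullet> v = u \<bullet> D v"
    and cpt: "compact (closure (blinfun_apply D ` cball 0 1))"
    and psd: "\<And>v. D v \<bullet> v \<ge> \<mu> * (norm v)\<^sup>2" and "\<mu> < 0"
    and inj: "\<And>v. D v = \<mu> *\<^sub>R v \<Longrightarrow> v = 0"
  shows "\<exists>c>0. \<forall>v. D v \<bullet> v \<ge> (\<mu> + c) * (norm v)\<^sup>2"
proof (rule ccontr)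
  assume neg: "\<not> ?thesis"
  define A where "A = D - \<mu> *\<^sub>R id_blinfun"
  have A: "A v = D v - \<mu> *\<^sub>R v" for v by (simp add: A_def blinfun.diff_left blinfun.scaleR_left)
  have "\<exists>v. norm v = 1 \<and> A v \<bullet> v < inverse (real (Suc n))" for n
  proof -
    have "inverse (real (Suc n)) > 0" by simp
    then obtain v where v: "D v \<bullet> v < (\<mu> + inverse (real (Suc n))) * (norm v)\<^sup>2"
      using neg by (meson not_le)
    then have "v \<noteq> 0" by auto
    then have "D (sgn v) \<bullet> sgn v < \<mu> + inverse (real (Suc n))"
      using v by (simp add: sgn_div_norm blinfun.scaleR_right power2_eq_square divide_simps)
    moreover have "norm (sgn v) = 1" using \<open>v \<noteq> 0\<close> by (simp add: norm_sgn)
    ultimately show ?thesis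
      by (intro exI[of _ "sgn v"]) (simp add: A inner_diff_left flip: power2_norm_eq_inner)
  qed
  then obtain v where v: "\<And>n. norm (v n) = 1" "\<And>n. A (v n) \<bullet> v n < inverse (real (Suc n))"
    by metis
  have lim: "(\<lambda>n. (norm A + 1) * inverse (real (Suc n))) \<longlonglongrightarrow> 0"
    using tendsto_mult[OF tendsto_const LIMSEQ_inverse_real_of_nat, of "norm A + 1"]
    unfolding mult_zero_right .
  have "(norm (A (v n)))\<^sup>2 \<le> (norm A + 1) * inverse (real (Suc n))" for n
  proof -
    have "(norm (A (v n)))\<^sup>2 \<le> (norm A + 1) * (A (v n) \<bullet> v n)"
    proof (rule semidefinite_norm_bound)
      show "A u \<bullet> w = u \<bullet> A w" for u w by (simp add: A sym inner_diff_left inner_diff_right)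
      show "A w \<bullet> w \<ge> 0" for w
        using psd[of w] by (simp add: A inner_diff_left power2_norm_eq_inner)
    qed
    also have "\<dots> \<le> (norm A + 1) * inverse (real (Suc n))"
      using v(2)[of n] by (intro mult_left_mono) auto
    finally show ?thesis .
  qed
  then have "(\<lambda>n. (norm (A (v n)))\<^sup>2) \<longlonglongrightarrow> 0"
    by (intro tendsto_sandwich[OF _ _ tendsto_const lim]) simp_all
  then have "(\<lambda>n. sqrt ((norm (A (v n)))\<^sup>2)) \<longlonglongrightarrow> sqrt 0" by (rule tendsto_real_sqrt)
  then have "(\<lambda>n. D (v n) - \<mu> *\<^sub>R v n) \<longlonglongrightarrow> 0" by (simp add: A tendsto_norm_zero_iff)
  moreover have "\<mu> \<noteq> 0" using \<open>\<mu> < 0\<close> by simp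
  ultimately obtain w where "w \<noteq> 0" "D w = \<mu> *\<^sub>R w"
    using approx_eigenvector_limit[OF cpt] v(1) by blast
  then show False using inj by blast
qed

section \<open>Gradients and the necessary conditions at minimizers\<close>

text \<open>Class C1 supplies some Frechet derivative of \<open>J_fun T\<close>; uniqueness of
  derivatives along each line identifies it with the Gateaux gradient \<open>T x\<close>.\<close>

lemma potential_operator_derivative:
  assumes "potential_operator T"
  shows "(J_fun T has_derivative (\<lambda>v. T x \<bullet> v)) (at x)"
proof -
  obtain f' where f': "(J_fun T has_derivative blinfun_apply (f' x)) (at x)"
    using assms unfolding potential_operator_def class_C1_def by blast
  have "blinfun_apply (f' x) v = T x \<bullet> v" for v
  proof (rule DERIV_unique)
    have "((\<lambda>t. J_fun T (x + t *\<^sub>R v)) has_derivative (\<lambda>t. f' x (t *\<^sub>R v))) (at 0)"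
      by (rule has_derivative_compose[where f = "\<lambda>t. x + t *\<^sub>R v"])
        (auto intro!: derivative_eq_intros f')
    then show "((\<lambda>t. J_fun T (x + t *\<^sub>R v)) has_real_derivative f' x v) (at 0)"
      by (rule has_derivative_imp_has_field_derivative) (simp add: blinfun.scaleR_right)
    show "((\<lambda>t. J_fun T (x + t *\<^sub>R v)) has_real_derivative T x \<bullet> v) (at 0)"
      using assms by (auto simp: potential_operator_def has_gateaux_gradient_def)
  qed
  then have "blinfun_apply (f' x) = (\<lambda>v. T x \<bullet> v)" by (rule ext)
  with f' show ?thesis by simp
qed

lemma gradient_line_derivative:
  fixes f :: "'a::real_inner \<Rightarrow> real"
  assumes "\<And>x. (f has_derivative (\<lambda>v. g x \<bullet> v)) (at x)"
  shows "((\<lambda>t. f (x + t *\<^sub>R v)) has_real_derivative g (x + t *\<^sub>R v) \<bullet> v) (at t)"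
proof -
  have "((\<lambda>t. f (x + t *\<^sub>R v)) has_derivative (\<lambda>s. g (x + t *\<^sub>R v) \<bullet> (s *\<^sub>R v))) (at t)"
    by (rule has_derivative_compose[where f = "\<lambda>t. x + t *\<^sub>R v"])
      (auto intro!: derivative_eq_intros assms)
  then show ?thesis by (rule has_derivative_imp_has_field_derivative) simp
qed

lemma gradient_mvt:
  fixes f :: "'a::real_inner \<Rightarrow> real"
  assumes "\<And>x. (f has_derivative (\<lambda>v. g x \<bullet> v)) (at x)" and "r > 0"
  shows "\<exists>t. 0 < t \<and> t < r \<and> f (x + r *\<^sub>R v) - f x = r * (g (x + t *\<^sub>R v) \<bullet> v)"
proof -
  obtain t where "0 < t" "t < r"
    "f (x + r *\<^sub>R v) - f (x + 0 *\<^sub>R v) = (r - 0) * (g (x + t *\<^sub>R v) \<bullet> v)"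
    using MVT2[OF \<open>r > 0\<close>, of "\<lambda>t. f (x + t *\<^sub>R v)" "\<lambda>t. g (x + t *\<^sub>R v) \<bullet> v"]
      gradient_line_derivative[OF assms(1)] by blast
  then show ?thesis by (intro exI[of _ t]) simp
qed

text \<open>Right difference quotients in the direction \<open>- g x\<close> are at least
  \<open>- e * norm (g x)\<close> and tend to minus the square of \<open>norm (g x)\<close>. The
  case \<open>e = 0\<close> is Fermat's rule for exact minimizers.\<close>

lemma almost_minimizer_gradient:
  fixes f :: "'a::real_inner \<Rightarrow> real"
  assumes der: "\<And>x. (f has_derivative (\<lambda>v. g x \<bullet> v)) (at x)"
    and min: "\<And>z. f x \<le> f z + e * dist x z" and "e \<ge> 0"
  shows "norm (g x) \<le> e"
proof (cases "g x = 0")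
  case False
  define v where "v = - g x"
  have "((\<lambda>t. f (x + t *\<^sub>R v)) has_real_derivative g x \<bullet> v) (at 0)"
    using gradient_line_derivative[OF der, where t = 0] by simp
  then have "((\<lambda>t. (f (x + t *\<^sub>R v) - f x) / t) \<longlongrightarrow> g x \<bullet> v) (at 0)"
    by (simp add: DERIV_def)
  then have "((\<lambda>t. (f (x + t *\<^sub>R v) - f x) / t) \<longlongrightarrow> g x \<bullet> v) (at_right 0)"
    by (rule tendsto_within_subset) simp
  moreover have "\<forall>\<^sub>F t in at_right 0. - (e * norm v) \<le> (f (x + t *\<^sub>R v) - f x) / t"
    unfolding eventually_at_right_field
  proof (intro exI[of _ 1] conjI allI impI)
    fix t :: real assume t: "0 < t" "t < 1"
    have "- (e * norm v) * t \<le> f (x + t *\<^sub>R v) - f x"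
      using min[of "x + t *\<^sub>R v"] t by (simp add: dist_norm algebra_simps)
    then show "- (e * norm v) \<le> (f (x + t *\<^sub>R v) - f x) / t" using t by (simp add: pos_le_divide_eq)
  qed simp
  ultimately have "- (e * norm v) \<le> g x \<bullet> v"
    by (rule tendsto_lowerbound) simp
  then have "norm (g x) * norm (g x) \<le> e * norm (g x)"
    by (simp add: v_def norm_eq_sqrt_inner)
  with False show ?thesis by simp
qed (use \<open>e \<ge> 0\<close> in simp)

text \<open>The gradient vanishes at \<open>x\<close>. Were \<open>D v \<bullet> v\<close> negative,
  the slope along \<open>v\<close> would be negative just after 0, and the mean value theorem would
  give a value below the minimum.\<close>

lemma minimizer_second_order:
  fixes f :: "'a::real_inner \<Rightarrow> real"
  assumes der: "\<And>x. (f has_derivative (\<lambda>v. g x \<bullet> v)) (at x)"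
    and der2: "(g has_derivative D) (at x)"
    and min: "\<And>z. f x \<le> f z"
  shows "D v \<bullet> v \<ge> 0"
proof (rule ccontr)
  assume neg: "\<not> D v \<bullet> v \<ge> 0"
  interpret D: bounded_linear D using der2 by (rule has_derivative_bounded_linear)
  have "norm (g x) \<le> 0"
    by (rule almost_minimizer_gradient[OF der]) (use min in auto)
  then have crit: "g x = 0" by simp
  define h where "h t = g (x + t *\<^sub>R v) \<bullet> v" for t
  have "((\<lambda>t. g (x + t *\<^sub>R v)) has_derivative (\<lambda>s. D (s *\<^sub>R v))) (at 0)"
    by (rule has_derivative_compose[where f = "\<lambda>t. x + t *\<^sub>R v"])
      (auto intro!: derivative_eq_intros der2)
  then have "(h has_derivative (\<lambda>s. D (s *\<^sub>R v) \<bullet> v)) (at 0)"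
    unfolding h_def by (rule has_derivative_inner_left)
  then have "(h has_real_derivative D v \<bullet> v) (at 0)"
    by (rule has_derivative_imp_has_field_derivative) (simp add: D.scaleR)
  then obtain d where d: "d > 0" "\<And>t. 0 < t \<Longrightarrow> t < d \<Longrightarrow> h (0 + t) < h 0"
    using DERIV_neg_dec_right[of h "D v \<bullet> v" 0] neg by auto
  have "d / 2 > 0" using d by simp
  from gradient_mvt[OF der this, of x v] obtain t where
    t: "0 < t" "t < d / 2" "f (x + (d / 2) *\<^sub>R v) - f x = (d / 2) * h t"
    unfolding h_def by blast
  have "h t < 0" using d(2)[of t] t crit by (simp add: h_def)
  then have "d / 2 * h t < 0" using d by (simp add: mult_pos_neg)
  with t(3) min[of "x + (d / 2) *\<^sub>R v"] show False by linarith
qed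

section \<open>Global minimizers of the perturbed functionals\<close>

lemma compact_operator_bounded:
  assumes "compact_operator T" "bounded B"
  shows "bounded (T ` B)"
proof -
  have "compact (closure (T ` B))" using assms by (simp add: compact_operator_def)
  then show ?thesis by (rule bounded_subset[OF compact_imp_bounded closure_subset])
qed

text \<open>A Palais-Smale property for gradients \<open>T x + m *\<^sub>R x\<close>:
  \<open>T (x n)\<close> converges along a subsequence, and subtraction leaves
  \<open>m *\<^sub>R x n\<close>.\<close>

lemma compact_perturbation_subsequence:
  fixes T :: "'a::real_normed_vector \<Rightarrow> 'a" and x :: "nat \<Rightarrow> 'a"
  assumes cpt: "compact_operator T" and "m \<noteq> 0" and bdd: "\<And>n. norm (x n) \<le> K"
    and lim: "(\<lambda>n. T (x n) + m *\<^sub>R x n) \<longlonglongrightarrow> y"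
  shows "\<exists>q l. strict_mono q \<and> (x \<circ> q) \<longlonglongrightarrow> l"
proof -
  have "\<forall>n. T (x n) \<in> closure (T ` cball 0 K)"
    using bdd by (intro allI closure_subset[THEN subsetD] imageI) simp
  moreover have "compact (closure (T ` cball 0 K))"
    using cpt by (simp add: compact_operator_def)
  ultimately obtain w q where q: "strict_mono (q :: nat \<Rightarrow> nat)"
    and w: "((\<lambda>n. T (x n)) \<circ> q) \<longlonglongrightarrow> w"
    unfolding compact_def by metis
  have "(\<lambda>n. T (x (q n))) \<longlonglongrightarrow> w" using w by (simp add: o_def)
  moreover have "(\<lambda>n. T (x (q n)) + m *\<^sub>R x (q n)) \<longlonglongrightarrow> y"
    using LIMSEQ_subseq_LIMSEQ[OF lim q] by (simp add: o_def)
  ultimately have "(\<lambda>n. inverse m *\<^sub>R (T (x (q n)) + m *\<^sub>R x (q n) - T (x (q n))))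
      \<longlonglongrightarrow> inverse m *\<^sub>R (y - w)"
    by (intro tendsto_intros)
  then have "(x \<circ> q) \<longlonglongrightarrow> inverse m *\<^sub>R (y - w)" using \<open>m \<noteq> 0\<close> by (simp add: o_def)
  with q show ?thesis by blast
qed

text \<open>Outside a large ball the growth condition gives the bound with no constant. Inside, the
  mean value theorem and the boundedness of \<open>T\<close> on the ball control
  \<open>J\<close>.\<close>

lemma potential_lower_bound:
  fixes J :: "'a::real_inner \<Rightarrow> real"
  assumes der: "\<And>x. (J has_derivative (\<lambda>v. T x \<bullet> v)) (at x)"
    and cpt: "compact_operator T"
    and liminf: "Liminf at_infinity (\<lambda>x. ereal (J x / (norm x)\<^sup>2)) \<ge> 0" and "m > 0"
  shows "\<exists>C. \<forall>x. J x \<ge> - (m * (norm x)\<^sup>2) - C"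
proof -
  have "ereal (- m) < 0" using \<open>m > 0\<close> by simp
  then have "\<forall>\<^sub>F x in at_infinity. ereal (- m) < ereal (J x / (norm x)\<^sup>2)"
    using liminf unfolding le_Liminf_iff by blast
  then obtain b where b: "\<And>x. norm x \<ge> b \<Longrightarrow> - m < J x / (norm x)\<^sup>2"
    by (auto simp: eventually_at_infinity)
  \<comment> \<open>At least 1, so that outside the ball the division by the squared norm can be
    undone.\<close>
  define R where "R = max b 1"
  obtain M where M: "\<And>x. norm x \<le> R \<Longrightarrow> norm (T x) \<le> M"
    using compact_operator_bounded[OF cpt bounded_cball[of 0 R]] unfolding bounded_iff
    by (metis imageI mem_cball_0)
  have "M \<ge> 0" using order_trans[OF norm_ge_zero M[of 0]] by (simp add: R_def)
  have "J x \<ge> - (m * (norm x)\<^sup>2) - (\<bar>J 0\<bar> + M * R)" for x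
  proof (cases "norm x \<le> R")
    case True
    obtain t where t: "0 < t" "t < 1" "J (0 + 1 *\<^sub>R x) - J 0 = 1 * (T (0 + t *\<^sub>R x) \<bullet> x)"
      using gradient_mvt[OF der, of 1 0 x] by auto
    have "norm (t *\<^sub>R x) \<le> R" using True t mult_left_le_one_le[of "norm x" t] by simp
    then have "norm (T (t *\<^sub>R x)) * norm x \<le> M * R"
      using M True \<open>M \<ge> 0\<close> by (intro mult_mono) auto
    then have "\<bar>T (t *\<^sub>R x) \<bullet> x\<bar> \<le> M * R"
      using Cauchy_Schwarz_ineq2 order_trans by blast
    moreover have "0 \<le> m * (norm x)\<^sup>2" using \<open>m > 0\<close> by simp
    moreover have "J x = J 0 + T (t *\<^sub>R x) \<bullet> x" using t(3) by simp
    ultimately show ?thesis by linarith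
  next
    case False
    then have "norm x > 0" "norm x \<ge> b" by (auto simp: R_def)
    then have "- (m * (norm x)\<^sup>2) < J x" using b[of x] by (simp add: pos_less_divide_eq)
    moreover have "0 \<le> M * R" using \<open>M \<ge> 0\<close> by (simp add: R_def)
    ultimately show ?thesis by linarith
  qed
  then show ?thesis by blast
qed

text \<open>By \<open>low\<close> the functional grows at least like
  \<open>m / 4 * (norm x)\<^sup>2\<close> up to linear terms. The slack \<open>norm x\<close> in
  \<open>sub\<close> covers Ekeland points as well as exact minimizers, and the bound is uniform in
  \<open>y\<close>.\<close>

lemma sublevel_bound:
  fixes J :: "'a::real_inner \<Rightarrow> real"
  assumes low: "\<And>x. J x \<ge> - (m / 4 * (norm x)\<^sup>2) - C" and m: "m > 0"
    and y: "norm y \<le> r"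
    and sub: "J x + m / 2 * (x \<bullet> x) - y \<bullet> x \<le> J 0 + norm x"
  shows "norm x \<le> 1 + 4 / m * (\<bar>C\<bar> + \<bar>J 0\<bar> + r + 1)"
proof (cases "norm x \<le> 1")
  case True
  have "r \<ge> 0" using y norm_ge_zero order_trans by blast
  with True m show ?thesis by (simp add: add_increasing2)
next
  case False
  define a where "a = norm x"
  have "a > 1" using False by (simp add: a_def)
  have "y \<bullet> x \<le> r * a"
    using norm_cauchy_schwarz[of y x] mult_right_mono[OF y norm_ge_zero[of x]] by (simp add: a_def)
  then have "m / 4 * a\<^sup>2 \<le> (\<bar>C\<bar> + \<bar>J 0\<bar>) * 1 + (r + 1) * a"
    using sub low[of x] by (simp add: a_def power2_norm_eq_inner algebra_simps)
  \<comment> \<open>Since \<open>a > 1\<close>, the constant may be made a multiple of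
    \<open>a\<close>, and one factor \<open>a\<close> then cancels.\<close>
  also have "\<dots> \<le> (\<bar>C\<bar> + \<bar>J 0\<bar>) * a + (r + 1) * a"
    using \<open>a > 1\<close> by (intro add_right_mono mult_left_mono) auto
  finally have "(m / 4 * a) * a \<le> (\<bar>C\<bar> + \<bar>J 0\<bar> + r + 1) * a"
    by (simp add: power2_eq_square algebra_simps)
  then have "m / 4 * a \<le> \<bar>C\<bar> + \<bar>J 0\<bar> + r + 1" using \<open>a > 1\<close> by simp
  then have "a \<le> 4 / m * (\<bar>C\<bar> + \<bar>J 0\<bar> + r + 1)" using m by (simp add: field_simps)
  then show ?thesis by (simp add: a_def)
qed

lemma perturbed_has_derivative:
  fixes J :: "'a::real_inner \<Rightarrow> real"
  assumes "\<And>x. (J has_derivative (\<lambda>v. T x \<bullet> v)) (at x)"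
  shows "((\<lambda>x. J x + m / 2 * (x \<bullet> x) - y \<bullet> x) has_derivative
    (\<lambda>v. (T x + m *\<^sub>R x - y) \<bullet> v)) (at x)"
  by (auto intro!: derivative_eq_intros assms
      simp: inner_add_left inner_diff_left inner_commute algebra_simps)

text \<open>Ekeland points with tolerance tending to 0 are bounded and have gradients tending to 0,
  so a subsequence converges. Passing to the limit in Ekeland's inequality makes the limit a
  minimizer.\<close>

lemma perturbed_minimizer_exists:
  fixes T :: "'a::{real_inner, complete_space} \<Rightarrow> 'a"
  assumes der: "\<And>x. (J has_derivative (\<lambda>v. T x \<bullet> v)) (at x)"
    and cpt: "compact_operator T"
    and low: "\<And>x. J x \<ge> - (m / 4 * (norm x)\<^sup>2) - C" and m: "m > 0"
  shows "\<exists>x. \<forall>z. J x + m / 2 * (x \<bullet> x) - y \<bullet> x \<le> J z + m / 2 * (z \<bullet> z) - y \<bullet> z"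
proof -
  define f where "f x = J x + m / 2 * (x \<bullet> x) - y \<bullet> x" for x
  have fder: "(f has_derivative (\<lambda>v. (T x + m *\<^sub>R x - y) \<bullet> v)) (at x)" for x
    unfolding f_def by (rule perturbed_has_derivative[OF der])
  have cont: "continuous_on UNIV f"
    by (meson continuous_at_imp_continuous_on fder has_derivative_continuous)
  have bdd: "- C - (norm y)\<^sup>2 / m \<le> f x" for x
  proof -
    \<comment> \<open>Completing the square bounds the linear term \<open>y \<bullet> x\<close>
      against the remaining quadratic growth.\<close>
    have "0 \<le> m / 4 * (norm x - 2 * norm y / m)\<^sup>2" using m by simp
    also have "\<dots> = m / 4 * (norm x)\<^sup>2 - norm y * norm x + (norm y)\<^sup>2 / m"
      using m by (simp add: power2_eq_square field_simps)
    finally show ?thesis using low[of x] norm_cauchy_schwarz[of y x]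
      by (simp add: f_def power2_norm_eq_inner)
  qed
  have "\<exists>x. \<forall>z. f x \<le> f z + inverse (real (Suc n)) * dist x z" for n
    by (rule ekeland[OF cont bdd]) simp
  then obtain x where x: "\<And>n z. f (x n) \<le> f z + inverse (real (Suc n)) * dist (x n) z"
    by metis
  have "norm (x n) \<le> 1 + 4 / m * (\<bar>C\<bar> + \<bar>J 0\<bar> + norm y + 1)" for n
  proof (rule sublevel_bound[OF low m order_refl])
    have "inverse (real (Suc n)) * norm (x n) \<le> 1 * norm (x n)"
      by (intro mult_right_mono) (auto simp: inverse_le_1_iff)
    then show "J (x n) + m / 2 * (x n \<bullet> x n) - y \<bullet> x n \<le> J 0 + norm (x n)"
      using x[of n 0] by (simp add: f_def)
  qed
  moreover have "(\<lambda>n. T (x n) + m *\<^sub>R x n) \<longlonglongrightarrow> y"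
  proof -
    have "norm (T (x n) + m *\<^sub>R x n - y) \<le> inverse (real (Suc n))" for n
      by (rule almost_minimizer_gradient[OF fder]) (use x in auto)
    then have "(\<lambda>n. T (x n) + m *\<^sub>R x n - y) \<longlonglongrightarrow> 0"
      by (intro Lim_null_comparison[OF _ LIMSEQ_inverse_real_of_nat]) simp
    then show ?thesis by (simp add: LIM_zero_iff)
  qed
  ultimately obtain q l where q: "strict_mono (q :: nat \<Rightarrow> nat)" and l: "(x \<circ> q) \<longlonglongrightarrow> l"
    using compact_perturbation_subsequence[OF cpt, of m x] m by blast
  have "f l \<le> f z" for z
  proof (rule LIMSEQ_le)
    have "isCont f l" using cont by (simp add: continuous_on_eq_continuous_at)
    then show "(\<lambda>n. f ((x \<circ> q) n)) \<longlonglongrightarrow> f l" using l by (rule isCont_tendsto_compose)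
    have "((\<lambda>n. inverse (real (Suc n))) \<circ> q) \<longlonglongrightarrow> 0"
      using LIMSEQ_inverse_real_of_nat q by (rule LIMSEQ_subseq_LIMSEQ)
    then have "(\<lambda>n. f z + ((\<lambda>n. inverse (real (Suc n))) \<circ> q) n * dist ((x \<circ> q) n) z)
        \<longlonglongrightarrow> f z + 0 * dist l z"
      by (intro tendsto_intros l)
    then show "(\<lambda>n. f z + inverse (real (Suc (q n))) * dist (x (q n)) z) \<longlonglongrightarrow> f z"
      by (simp add: o_def)
    show "\<exists>N. \<forall>n\<ge>N. f ((x \<circ> q) n) \<le> f z + inverse (real (Suc (q n))) * dist (x (q n)) z"
      using x by simp
  qed
  then show ?thesis unfolding f_def by blast
qed

section \<open>The set where \<mu> is an eigenvalue of the derivative\<close>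

text \<open>By continuity in the operator norm, unit eigenvectors at points tending to
  \<open>l\<close> are approximate eigenvectors of \<open>D l\<close>.\<close>

lemma closed_eigenvalue_set:
  fixes D :: "'a::real_normed_vector \<Rightarrow> 'a \<Rightarrow>\<^sub>L 'a"
  assumes cont: "continuous_on UNIV D" and "\<mu> \<noteq> 0"
    and cpt: "\<And>x. compact (closure (blinfun_apply (D x) ` cball 0 1))"
  shows "closed {x. \<exists>v. v \<noteq> 0 \<and> D x v = \<mu> *\<^sub>R v}"
  unfolding closed_sequential_limits
proof (intro allI impI, elim conjE)
  fix x l
  assume ex: "\<forall>n. x n \<in> {x. \<exists>v. v \<noteq> 0 \<and> D x v = \<mu> *\<^sub>R v}" and lim: "x \<longlonglongrightarrow> l"
  have "\<exists>v. norm v = 1 \<and> D (x n) v = \<mu> *\<^sub>R v" for n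
  proof -
    obtain v where "v \<noteq> 0" "D (x n) v = \<mu> *\<^sub>R v" using ex by blast
    then show ?thesis
      by (intro exI[of _ "sgn v"]) (simp add: norm_sgn sgn_div_norm blinfun.scaleR_right)
  qed
  then obtain v where v: "\<And>n. norm (v n) = 1" "\<And>n. D (x n) (v n) = \<mu> *\<^sub>R v n" by metis
  have "isCont D l" using cont by (simp add: continuous_on_eq_continuous_at)
  then have "(\<lambda>n. D (x n)) \<longlonglongrightarrow> D l" using lim by (rule isCont_tendsto_compose)
  then have dist0: "(\<lambda>n. dist (D (x n)) (D l)) \<longlonglongrightarrow> 0" by (rule tendsto_dist_iff[THEN iffD1])
  have bound: "norm (D l (v n) - \<mu> *\<^sub>R v n) \<le> dist (D (x n)) (D l)" for n
    using norm_blinfun[of "D l - D (x n)" "v n"] v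
    by (simp add: blinfun.diff_left dist_norm norm_minus_commute[of "D (x n)"])
  have "(\<lambda>n. D l (v n) - \<mu> *\<^sub>R v n) \<longlonglongrightarrow> 0"
    by (rule Lim_null_comparison[OF always_eventually[OF allI[OF bound]] dist0])
  from approx_eigenvector_limit[OF cpt \<open>\<mu> \<noteq> 0\<close> v(1) this]
  show "l \<in> {x. \<exists>v. v \<noteq> 0 \<and> D x v = \<mu> *\<^sub>R v}" by simp
qed

text \<open>The set \<open>P\<close> is closed. It is relatively open in \<open>C\<close> because
  there \<open>inj\<close> improves semidefiniteness to a uniform margin \<open>c\<close>, which
  survives any change of \<open>D\<close> smaller than \<open>c\<close> in operator norm.\<close>

lemma semidefinite_on_connected:
  fixes D :: "'a::real_inner \<Rightarrow> 'a \<Rightarrow>\<^sub>L 'a"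
  assumes cont: "continuous_on UNIV D" and "\<mu> < 0"
    and sym: "\<And>x u v. D x u \<bullet> v = u \<bullet> D x v"
    and cpt: "\<And>x. compact (closure (blinfun_apply (D x) ` cball 0 1))"
    and conn: "connected C" and inj: "\<And>x v. x \<in> C \<Longrightarrow> D x v = \<mu> *\<^sub>R v \<Longrightarrow> v = 0"
    and a: "a \<in> C" "\<And>v. D a v \<bullet> v \<ge> \<mu> * (norm v)\<^sup>2" and b: "b \<in> C"
  shows "D b v \<bullet> v \<ge> \<mu> * (norm v)\<^sup>2"
proof -
  define P where "P = {x. \<forall>v. \<mu> * (norm v)\<^sup>2 \<le> D x v \<bullet> v}"
  have "closed P" unfolding P_def
    by (intro closed_Collect_all closed_Collect_le continuous_intros cont)
  then have "closedin (top_of_set C) (C \<inter> P)" by (rule closedin_closed_Int)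
  moreover have "openin (top_of_set C) (C \<inter> P)"
    unfolding openin_contains_ball
  proof (intro conjI ballI)
    fix x assume x: "x \<in> C \<inter> P"
    have "\<exists>c>0. \<forall>v. D x v \<bullet> v \<ge> (\<mu> + c) * (norm v)\<^sup>2"
    proof (rule positive_definite_of_semidefinite[OF sym cpt _ \<open>\<mu> < 0\<close>])
      show "\<mu> * (norm v)\<^sup>2 \<le> D x v \<bullet> v" for v using x by (simp add: P_def)
      show "v = 0" if "D x v = \<mu> *\<^sub>R v" for v using inj[OF _ that] x by blast
    qed
    then obtain c where c: "c > 0" "\<And>v. D x v \<bullet> v \<ge> (\<mu> + c) * (norm v)\<^sup>2" by blast
    have "isCont D x" using cont by (simp add: continuous_on_eq_continuous_at)
    from this[unfolded continuous_at_eps_delta, rule_format, OF c(1)]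
    obtain d where d: "d > 0" "\<And>y. dist y x < d \<Longrightarrow> dist (D y) (D x) < c" by blast
    have "y \<in> P" if "dist x y < d" for y
      unfolding P_def
    proof (intro CollectI allI)
      fix v
      have "norm (D x - D y) \<le> c" using d(2)[of y] that by (simp add: dist_commute dist_norm[symmetric])
      have "(D x - D y) v \<bullet> v \<le> norm ((D x - D y) v) * norm v" by (rule norm_cauchy_schwarz)
      also have "\<dots> \<le> (norm (D x - D y) * norm v) * norm v"
        by (intro mult_right_mono norm_blinfun norm_ge_zero)
      also have "\<dots> \<le> (c * norm v) * norm v"
        using \<open>norm (D x - D y) \<le> c\<close> by (intro mult_right_mono norm_ge_zero)
      finally show "\<mu> * (norm v)\<^sup>2 \<le> D y v \<bullet> v"
        using c(2)[of v] by (simp add: blinfun.diff_left inner_diff_left power2_eq_square algebra_simps)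
    qed
    then show "\<exists>e>0. ball x e \<inter> C \<subseteq> C \<inter> P" using d(1) by auto
  qed simp
  ultimately have "C \<inter> P = {} \<or> C \<inter> P = C" using conn unfolding connected_clopen by blast
  moreover have "a \<in> C \<inter> P" using a by (simp add: P_def)
  ultimately show ?thesis using b by (auto simp: P_def)
qed

text \<open>Membership of the accumulation point is left to \<open>closed_eigenvalue_set\<close>.
  The assumption \<open>dim\<close> supplies the direction in which a segment is tilted to avoid the
  set.\<close>

lemma eigenvalue_set_islimpt:
  fixes T :: "'a::{real_inner, complete_space} \<Rightarrow> 'a" and D :: "'a \<Rightarrow> 'a \<Rightarrow>\<^sub>L 'a"
  assumes dim: "\<And>w::'a. \<exists>v. v \<notin> span {w}"
    and J: "\<And>x. (J has_derivative (\<lambda>v. T x \<bullet> v)) (at x)"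
    and D: "\<And>x. (T has_derivative blinfun_apply (D x)) (at x)" and cont: "continuous_on UNIV D"
    and cpt: "compact_operator T"
    and liminf: "Liminf at_infinity (\<lambda>x. ereal (J x / (norm x)\<^sup>2)) \<ge> 0" and "\<mu> < 0"
    and neg: "D x0 y0 \<bullet> y0 < \<mu> * (norm y0)\<^sup>2"
  shows "\<exists>x. x islimpt {x. \<exists>v. v \<noteq> 0 \<and> D x v = \<mu> *\<^sub>R v}"
proof (rule ccontr)
  define S where "S = {x. \<exists>v. v \<noteq> 0 \<and> D x v = \<mu> *\<^sub>R v}"
  assume "\<not> ?thesis"
  then have nolim: "\<And>x. \<not> x islimpt S" by (simp add: S_def)
  define m where "m = - \<mu>"
  have m: "m > 0" using \<open>\<mu> < 0\<close> by (simp add: m_def)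
  \<comment> \<open>Half of the coefficient \<open>m / 2\<close> of the added quadratic, so that
    \<open>m / 4\<close> is left for coercivity.\<close>
  then obtain C where low: "\<And>x. J x \<ge> - (m / 4 * (norm x)\<^sup>2) - C"
    using potential_lower_bound[OF J cpt liminf, of "m / 4"] by auto
  obtain e :: 'a where "e \<noteq> 0" using dim[of 0] span_zero by metis
  \<comment> \<open>Distinct vectors tending to 0. By \<open>crit\<close> each \<open>y n\<close> is
    determined by its minimizer, so the minimizers are distinct as well.\<close>
  define y where "y n = inverse (real (Suc n)) *\<^sub>R sgn e" for n
  define f where "f n x = J x + m / 2 * (x \<bullet> x) - y n \<bullet> x" for n x
  have fder: "(f n has_derivative (\<lambda>v. (T x + m *\<^sub>R x - y n) \<bullet> v)) (at x)" for n x
    unfolding f_def by (rule perturbed_has_derivative[OF J])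
  have "\<exists>x. \<forall>z. f n x \<le> f n z" for n
    unfolding f_def by (rule perturbed_minimizer_exists[OF J cpt low m])
  then obtain x where x: "\<And>n z. f n (x n) \<le> f n z" by metis
  have crit: "T (x n) + m *\<^sub>R x n = y n" for n
  proof -
    have "norm (T (x n) + m *\<^sub>R x n - y n) \<le> 0"
      by (rule almost_minimizer_gradient[OF fder]) (use x in auto)
    then show ?thesis by simp
  qed
  have "\<exists>n. x n \<notin> S"
  proof (rule ccontr)
    assume "\<not> ?thesis"
    then have xS: "\<And>n. x n \<in> S" by blast
    have "inj y" using \<open>e \<noteq> 0\<close> by (auto simp: inj_on_def y_def sgn_zero_iff)
    then have "inj x" using crit by (metis injD injI)
    have "norm (x n) \<le> 1 + 4 / m * (\<bar>C\<bar> + \<bar>J 0\<bar> + 1 + 1)" for n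
    proof (rule sublevel_bound[OF low m])
      show "norm (y n) \<le> 1" using \<open>e \<noteq> 0\<close> by (simp add: y_def norm_sgn inverse_le_1_iff)
      show "J (x n) + m / 2 * (x n \<bullet> x n) - y n \<bullet> x n \<le> J 0 + norm (x n)"
        using x[of n 0] by (simp add: f_def add_increasing2)
    qed
    moreover have "(\<lambda>n. T (x n) + m *\<^sub>R x n) \<longlonglongrightarrow> 0 *\<^sub>R sgn e"
      unfolding crit y_def by (intro tendsto_intros LIMSEQ_inverse_real_of_nat)
    ultimately obtain q l where q: "strict_mono (q :: nat \<Rightarrow> nat)" and l: "(x \<circ> q) \<longlonglongrightarrow> l"
      using compact_perturbation_subsequence[OF cpt, of m x] m by blast
    have "inj (x \<circ> q)" using \<open>inj x\<close> q strict_mono_imp_inj_on inj_compose by blast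
    then show False using islimpt_inj_sequence[OF _ _ l, of S] xS nolim by simp
  qed
  then obtain n where aS: "x n \<notin> S" by blast
  define a where "a = x n"
  have psd: "D a v \<bullet> v \<ge> \<mu> * (norm v)\<^sup>2" for v
  proof -
    have "((\<lambda>x. T x + m *\<^sub>R x - y n) has_derivative (\<lambda>v. D a v + m *\<^sub>R v)) (at a)"
      by (auto intro!: derivative_eq_intros D)
    then have "(D a v + m *\<^sub>R v) \<bullet> v \<ge> 0"
      using minimizer_second_order[OF fder] x unfolding a_def by blast
    then show ?thesis by (simp add: inner_diff_left m_def power2_norm_eq_inner)
  qed
  have "a \<noteq> x0" using psd[of y0] neg by auto
  \<comment> \<open>The segment from \<open>a\<close> to \<open>x0\<close> may itself meet
    \<open>S\<close>. Continuity gives a radius within which the endpoint can be moved while the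
    inequality \<open>neg\<close> persists.\<close>
  have "isCont (\<lambda>x. D x y0 \<bullet> y0) x0"
  proof -
    have "isCont D x0" using cont by (simp add: continuous_on_eq_continuous_at)
    then show ?thesis by (intro continuous_intros)
  qed
  moreover have "0 < \<mu> * (norm y0)\<^sup>2 - D x0 y0 \<bullet> y0" using neg by simp
  ultimately obtain r where r: "r > 0"
    "\<And>z. dist z x0 < r \<Longrightarrow> dist (D z y0 \<bullet> y0) (D x0 y0 \<bullet> y0) < \<mu> * (norm y0)\<^sup>2 - D x0 y0 \<bullet> y0"
    unfolding continuous_at_eps_delta by blast
  obtain v where v: "v \<notin> span {x0 - a}" using dim by blast
  then have "v \<noteq> 0" using span_zero by metis
  then have "r / norm v > 0" using r by simp
  then obtain t where t: "0 < t" "t < r / norm v"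
    and seg: "closed_segment a (x0 + t *\<^sub>R v) \<inter> S = {}"
    using closed_segment_avoiding[OF nolim _ \<open>a \<noteq> x0\<close> v] aS unfolding a_def by blast
  define z where "z = x0 + t *\<^sub>R v"
  have "dist z x0 < r" using t \<open>v \<noteq> 0\<close> by (simp add: z_def dist_norm pos_less_divide_eq)
  then have "D z y0 \<bullet> y0 < \<mu> * (norm y0)\<^sup>2" using r(2)[of z] by (auto simp: dist_real_def)
  moreover have "D z y0 \<bullet> y0 \<ge> \<mu> * (norm y0)\<^sup>2"
  proof (rule semidefinite_on_connected[OF cont \<open>\<mu> < 0\<close>, where a = a and C = "closed_segment a z"])
    show "D x u \<bullet> v = u \<bullet> D x v" for x u v
      by (rule gradient_derivative_symmetric[OF J D])
    show "compact (closure (blinfun_apply (D x) ` cball 0 1))" for x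
      using cpt by (intro compact_derivative[OF _ D]) (simp add: compact_operator_def)
    show "connected (closed_segment a z)" by simp
    show "v = 0" if "x \<in> closed_segment a z" "D x v = \<mu> *\<^sub>R v" for x v
      using that seg by (auto simp: S_def z_def)
  qed (use psd in auto)
  ultimately show False by simp
qed

section \<open>Equivalence of the three assertions\<close>

theorem theorem3:
  fixes T :: "'a::{real_inner, complete_space} \<Rightarrow> 'a"
    and lam0 :: real
  assumes dim_ge_3: "\<exists>B :: 'a set. independent B \<and> card B = 3"
    and potential: "potential_operator T"
    and compact: "compact_operator T"
    and C1: "class_C1 T"
    and liminf: "Liminf at_infinity (\<lambda>x. ereal (J_fun T x / (norm x)\<^sup>2)) \<ge> 0"
    and lam0_nonneg: "lam0 \<ge> 0"
    and coercive: "\<And>l. l > lam0 \<Longrightarrow> filterlim (\<lambda>x. norm (x + l *\<^sub>R T x)) at_top at_infinity"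
  shows "(\<not> monotone_operator T \<longleftrightarrow> (\<exists>\<mu><0. A_set T \<mu> \<noteq> {}))
    \<and> ((\<exists>\<mu><0. A_set T \<mu> \<noteq> {}) \<longleftrightarrow>
        Gamma_set T \<noteq> {} \<and> (\<forall>\<mu>::real. mu_tilde T lam0 < ereal \<mu> \<and> \<mu> < 0
                        \<longrightarrow> (\<exists>x\<in>A_set T \<mu>. x islimpt A_set T \<mu>)))"
proof -
  obtain D :: "'a \<Rightarrow> 'a \<Rightarrow>\<^sub>L 'a" where
    D: "\<And>x. (T has_derivative blinfun_apply (D x)) (at x)" and cont: "continuous_on UNIV D"
    using C1 unfolding class_C1_def by blast
  have fD: "frechet_derivative T (at x) = blinfun_apply (D x)" for x
    using frechet_derivative_at[OF D] by simp
  have A: "A_set T \<mu> = {x. \<exists>v. v \<noteq> 0 \<and> D x v = \<mu> *\<^sub>R v}" for \<mu>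
    by (simp add: A_set_def fD)
  have G: "Gamma_set T = {(x, y). D x y \<bullet> y < 0}" by (simp add: Gamma_set_def fD)
  have dim: "\<exists>v. v \<notin> span {w}" for w :: 'a
  proof (rule ccontr)
    assume "\<not> ?thesis"
    then have sp: "B \<subseteq> span {w}" for B by blast
    obtain B :: "'a set" where B: "independent B" "card B = 3" using dim_ge_3 by blast
    have "card B \<le> card {w}" using independent_span_bound[OF _ B(1) sp] by simp
    with B(2) show False by simp
  qed
  let ?i = "\<not> monotone_operator T" and ?ii = "\<exists>\<mu><0. A_set T \<mu> \<noteq> {}"
  let ?iii = "Gamma_set T \<noteq> {} \<and> (\<forall>\<mu>::real. mu_tilde T lam0 < ereal \<mu> \<and> \<mu> < 0
                        \<longrightarrow> (\<exists>x\<in>A_set T \<mu>. x islimpt A_set T \<mu>))"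
  have 1: ?iii if ?i
  proof
    obtain x y where xy: "(T x - T y) \<bullet> (x - y) < 0"
      using \<open>?i\<close> by (auto simp: monotone_operator_def not_le)
    \<comment> \<open>The mean value theorem on the segment from \<open>y\<close> to
      \<open>x\<close> turns the failure of monotonicity into a point of \<Gamma> with direction
      \<open>x - y\<close>.\<close>
    define h where "h t = T (y + t *\<^sub>R (x - y)) \<bullet> (x - y)" for t
    have "((\<lambda>t. T (y + t *\<^sub>R (x - y))) has_derivative
        (\<lambda>s. D (y + t *\<^sub>R (x - y)) (s *\<^sub>R (x - y)))) (at t)" for t
      by (rule has_derivative_compose[where f = "\<lambda>t. y + t *\<^sub>R (x - y)"])
        (auto intro!: derivative_eq_intros D)
    then have "(h has_derivative (\<lambda>s. D (y + t *\<^sub>R (x - y)) (s *\<^sub>R (x - y)) \<bullet> (x - y))) (at t)" for t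
      unfolding h_def by (rule has_derivative_inner_left)
    then have "(h has_real_derivative D (y + t *\<^sub>R (x - y)) (x - y) \<bullet> (x - y)) (at t)" for t
      by (rule has_derivative_imp_has_field_derivative) (simp add: blinfun.scaleR_right)
    then obtain t where "h 1 - h 0 = (1 - 0) * (D (y + t *\<^sub>R (x - y)) (x - y) \<bullet> (x - y))"
      using MVT2[of 0 1 h "\<lambda>t. D (y + t *\<^sub>R (x - y)) (x - y) \<bullet> (x - y)"] by auto
    with xy have "D (y + t *\<^sub>R (x - y)) (x - y) \<bullet> (x - y) < 0"
      by (simp add: h_def inner_diff_left)
    then show "Gamma_set T \<noteq> {}" by (auto simp: G)
    show "\<forall>\<mu>::real. mu_tilde T lam0 < ereal \<mu> \<and> \<mu> < 0
                        \<longrightarrow> (\<exists>x\<in>A_set T \<mu>. x islimpt A_set T \<mu>)"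
    proof (intro allI impI, elim conjE)
      fix \<mu> :: real
      assume "mu_tilde T lam0 < ereal \<mu>" and "\<mu> < 0"
      \<comment> \<open>Exceeding the maximum means exceeding the infimum, so some Rayleigh quotient
        over \<Gamma> lies strictly below \<mu>.\<close>
      then have "(INF (x, y)\<in>Gamma_set T. ereal (D x y \<bullet> y / (norm y)\<^sup>2)) < ereal \<mu>"
        by (simp add: mu_tilde_def fD)
      then obtain x0 y0 where "(x0, y0) \<in> Gamma_set T"
        and less: "D x0 y0 \<bullet> y0 / (norm y0)\<^sup>2 < \<mu>"
        unfolding INF_less_iff by auto
      then have "y0 \<noteq> 0" by (auto simp: G)
      then have "D x0 y0 \<bullet> y0 < \<mu> * (norm y0)\<^sup>2" using less by (simp add: pos_divide_less_eq)
      then obtain x where x: "x islimpt A_set T \<mu>"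
        using eigenvalue_set_islimpt[OF dim potential_operator_derivative[OF potential] D cont
            compact liminf \<open>\<mu> < 0\<close>] unfolding A by blast
      have "closed (A_set T \<mu>)"
        unfolding A
      proof (rule closed_eigenvalue_set[OF cont])
        show "\<mu> \<noteq> 0" using \<open>\<mu> < 0\<close> by simp
        show "Topological_Spaces.compact (closure (blinfun_apply (D x) ` cball 0 1))" for x
          using compact by (intro compact_derivative[OF _ D]) (simp add: compact_operator_def)
      qed
      with x show "\<exists>x\<in>A_set T \<mu>. x islimpt A_set T \<mu>" by (auto simp: closed_limpt)
    qed
  qed
  \<comment> \<open>Both terms of the maximum are negative, so the interval of admissible \<mu> is
    nonempty.\<close>
  have 2: ?ii if ?iii
  proof -
    obtain x0 y0 where g: "(x0, y0) \<in> Gamma_set T" using \<open>?iii\<close> by auto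
    have "D x0 y0 \<bullet> y0 < 0" "y0 \<noteq> 0" using g by (auto simp: G)
    then have "D x0 y0 \<bullet> y0 / (norm y0)\<^sup>2 < 0" by (simp add: divide_neg_pos)
    then have "(INF (x, y)\<in>Gamma_set T. ereal (D x y \<bullet> y / (norm y)\<^sup>2)) < ereal 0"
      unfolding INF_less_iff using g by (intro bexI[of _ "(x0, y0)"]) auto
    moreover have "(if lam0 = 0 then -\<infinity> else ereal (- (1 / lam0))) < ereal 0"
      using lam0_nonneg by auto
    ultimately have "mu_tilde T lam0 < ereal 0" unfolding mu_tilde_def fD by (rule max_less_iff_conj[THEN iffD2, OF conjI, rotated])
    then obtain \<mu> where "mu_tilde T lam0 < ereal \<mu>" "ereal \<mu> < ereal 0"
      using ereal_dense2 by blast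
    then show ?ii using \<open>?iii\<close> by auto
  qed
  \<comment> \<open>Along an eigenvector \<open>v\<close> with negative eigenvalue,
    \<open>T (x + t *\<^sub>R v) \<bullet> v\<close> drops below its value at \<open>t = 0\<close>
    for small positive \<open>t\<close>, which contradicts monotonicity.\<close>
  have 3: ?i if ?ii
  proof
    assume mono: "monotone_operator T"
    obtain \<mu> x v where "\<mu> < 0" "v \<noteq> 0" and ev: "D x v = \<mu> *\<^sub>R v" using \<open>?ii\<close> by (auto simp: A)
    have "((\<lambda>t. T (x + t *\<^sub>R v)) has_derivative (\<lambda>s. D x (s *\<^sub>R v))) (at 0)"
      by (rule has_derivative_compose[where f = "\<lambda>t. x + t *\<^sub>R v"])
        (auto intro!: derivative_eq_intros D)
    then have "((\<lambda>t. T (x + t *\<^sub>R v) \<bullet> v) has_derivative (\<lambda>s. D x (s *\<^sub>R v) \<bullet> v)) (at 0)"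
      by (rule has_derivative_inner_left)
    then have "((\<lambda>t. T (x + t *\<^sub>R v) \<bullet> v) has_real_derivative D x v \<bullet> v) (at 0)"
      by (rule has_derivative_imp_has_field_derivative) (simp add: blinfun.scaleR_right)
    moreover have "D x v \<bullet> v < 0" using \<open>\<mu> < 0\<close> \<open>v \<noteq> 0\<close> by (simp add: ev mult_neg_pos)
    ultimately obtain d where d: "d > 0"
      "\<And>t. 0 < t \<Longrightarrow> t < d \<Longrightarrow> T (x + (0 + t) *\<^sub>R v) \<bullet> v < T (x + 0 *\<^sub>R v) \<bullet> v"
      using DERIV_neg_dec_right[of "\<lambda>t. T (x + t *\<^sub>R v) \<bullet> v" "D x v \<bullet> v" 0] by blast
    define t where "t = d / 2"
    have t: "0 < t" "t < d" using d by (auto simp: t_def)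
    have "(T (x + t *\<^sub>R v) - T x) \<bullet> v < 0" using d(2)[OF t] by (simp add: inner_diff_left)
    then have "t * ((T (x + t *\<^sub>R v) - T x) \<bullet> v) < 0" using t by (simp add: mult_pos_neg)
    moreover have "0 \<le> (T (x + t *\<^sub>R v) - T x) \<bullet> (x + t *\<^sub>R v - x)"
      using mono unfolding monotone_operator_def by blast
    ultimately show False by simp
  qed
  show ?thesis using 1 2 3 by blast
qed

end
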